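(* Let $G$ be a finite group, and let $g$ be an element of $G$ which maximizes, among all elements of $G$, the number of prime divisors of its order counted with multiplicity; let this number be $r$. Then $r\le \operatorname{diam}(\Gamma(G))\le 2r$.
   Context: For a finite group $G$, the cyclic subgroup graph $\Gamma(G)$ is the simple undirected graph whose vertex set is $C(G)$, the set of all cyclic subgroups of $G$ (including the trivial subgroup $\{e\}$), and in which two distinct vertices are adjacent if and only if one of them, $H_1$, is contained in the other, $H_2$, and there is no subgroup $K$ of $G$ with $H_1<K<H_2$ (strict inclusions). The diameter $\operatorname{diam}(\Gamma)$ of a connected graph $\Gamma$ is the maximum distance between two of its vertices (the graph $\Gamma(G)$ is always connected). *)

theory Defs
  imports "HOL-Algebra.Algebra" "Graph_Theory.Graph_Theory"
begin

definition cyclic_subgroups :: "('a, 'b) monoid_scheme \<Rightarrow> 'a set set" where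
  "cyclic_subgroups G = {H. subgroup H G \<and> cyclic_group (G\<lparr>carrier := H\<rparr>)}"

definition covered_by :: "('a, 'b) monoid_scheme \<Rightarrow> 'a set \<Rightarrow> 'a set \<Rightarrow> bool" where
  "covered_by G H1 H2 \<longleftrightarrow> H1 \<subset> H2 \<and> \<not> (\<exists>K. subgroup K G \<and> H1 \<subset> K \<and> K \<subset> H2)"

text \<open>An undirected edge is represented by the two arcs between its end points.\<close>

definition cyclic_subgroup_graph :: "('a, 'b) monoid_scheme \<Rightarrow> 'a set pair_pre_digraph" where
  "cyclic_subgroup_graph G = \<lparr> pverts = cyclic_subgroups G,
     parcs = {(H1, H2). H1 \<in> cyclic_subgroups G \<and> H2 \<in> cyclic_subgroups G \<and>
                        (covered_by G H1 H2 \<or> covered_by G H2 H1)} \<rparr>"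

lemma pair_graph_cyclic_subgroup_graph:
  assumes "finite (carrier G)"
  shows "pair_graph (cyclic_subgroup_graph G)"
proof -
  have "cyclic_subgroups G \<subseteq> Pow (carrier G)"
    by (auto simp: cyclic_subgroups_def dest: subgroup.subset)
  then have fin: "finite (cyclic_subgroups G)"
    using assms by (meson finite_Pow_iff finite_subset)
  then have "finite (parcs (cyclic_subgroup_graph G))"
    by (intro finite_subset[OF _ finite_cartesian_product[OF fin fin]])
      (auto simp: cyclic_subgroup_graph_def)
  with fin show ?thesis
    by unfold_locales
      (auto simp: cyclic_subgroup_graph_def covered_by_def symmetric_def sym_def)
qed

text \<open>
  With unit weights, \<open>wf_digraph.\<mu>\<close> is the least number of arcs of a walk, or \<open>\<infinity>\<close> if
  there is no walk; in particular the diameter of a disconnected graph is \<open>\<infinity>\<close>. The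
  supremum ranges over a finite set when the graph is finite, so it is then a maximum.
\<close>

definition graph_distance :: "('v, 'e) pre_digraph \<Rightarrow> 'v \<Rightarrow> 'v \<Rightarrow> ereal" where
  "graph_distance \<Gamma> u v = wf_digraph.\<mu> \<Gamma> (\<lambda>_. 1) u v"

definition diameter :: "('v, 'e) pre_digraph \<Rightarrow> ereal" where
  "diameter \<Gamma> = (SUP (u, v) \<in> verts \<Gamma> \<times> verts \<Gamma>. graph_distance \<Gamma> u v)"

end

theory Submission
  imports Defs
begin

text \<open>
  Let \<open>\<Omega> n\<close> be the number of prime divisors of \<open>n\<close> counted with multiplicity, and give a
  cyclic subgroup \<open>H\<close> the height \<open>\<Omega> \<bar>H\<bar>\<close>. A proper subgroup of \<open>\<langle>x\<rangle>\<close> is generated by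
  some \<open>x\<^sup>k\<close> with \<open>k\<close> not coprime to the order of \<open>x\<close>, hence lies in \<open>\<langle>x\<^sup>p\<rangle>\<close> for a prime
  \<open>p\<close> dividing the order of \<open>x\<close>; so a subgroup covered by \<open>\<langle>x\<rangle>\<close> has prime index in it,
  and heights of adjacent vertices differ by exactly one (\<open>prime_index_if_covered_by\<close>,
  \<open>height_if_covered_by\<close>). The distance of two vertices is therefore at least the
  difference of their heights. Applied to \<open>\<langle>g\<rangle>\<close>, of height \<open>r\<close>, and the trivial subgroup,
  of height \<open>0\<close>, this gives the lower bound.

  Conversely, \<open>\<langle>x\<^sup>p\<rangle>\<close> is covered by \<open>\<langle>x\<rangle>\<close> for every prime \<open>p\<close> dividing the order of \<open>x\<close>, since
  it has prime index. Descending in this way, a walk with as many arcs as the height, at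
  most \<open>r\<close>, joins any vertex to the trivial subgroup (\<open>walk_to_trivial\<close>). Any two
  vertices are thus joined through the trivial subgroup by a walk with at most \<open>2r\<close> arcs.
\<close>

section \<open>Maximal subgroups of finite cyclic groups\<close>

lemma size_prime_factorization_prime_mult:
  fixes p n :: nat
  assumes "Factorial_Ring.prime p" "n > 0"
  shows "size (prime_factorization (p * n)) = Suc (size (prime_factorization n))"
  using assms by (simp add: prime_factorization_mult prime_factorization_prime)

context group
begin

lemma card_subgroup_dvd_card_subgroup:
  assumes "subgroup H G" "subgroup K G" "H \<subseteq> K"
  shows "card H dvd card K"
proof -
  have "subgroup H (G\<lparr>carrier := K\<rparr>)"
    using assms by (simp add: subgroup_incl)
  then have "card (rcosets\<^bsub>G\<lparr>carrier := K\<rparr>\<^esub> H) * card H = order (G\<lparr>carrier := K\<rparr>)"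
    by (rule group.lagrange[OF subgroup_imp_group[OF assms(2)]])
  also have "\<dots> = card K"
    by (simp add: order_def)
  finally show ?thesis
    by (metis dvd_triv_right)
qed

lemma covered_by_if_prime_index:
  assumes "finite K" "subgroup H G" "subgroup K G" "H \<subseteq> K"
    and card: "card K = p * card H" and p: "Factorial_Ring.prime p"
  shows "covered_by G H K"
proof -
  have pos: "card H > 0"
    using finite_subset[OF assms(4,1)] subgroup.one_closed[OF assms(2)]
    by (auto simp: card_gt_0_iff)
  have "H \<noteq> K"
    using card p pos by (auto simp: prime_nat_iff)
  moreover have False if L: "subgroup L G" "H \<subset> L" "L \<subset> K" for L
  proof -
    obtain a where a: "card L = card H * a"
      using card_subgroup_dvd_card_subgroup[OF assms(2) L(1)] L(2) by blast
    obtain b where b: "card K = card L * b"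
      using card_subgroup_dvd_card_subgroup[OF L(1) assms(3)] L(3) by blast
    have "p = b * a"
      using a b card pos by simp
    then have "a = 1 \<or> b = 1"
      using p prime_product[of b a] by auto
    moreover have "card L < card K"
      using L(3) assms(1) by (rule psubset_card_mono[rotated])
    moreover have "card H < card L"
      using L(2) finite_subset[OF psubset_imp_subset[OF L(3)] assms(1)]
      by (rule psubset_card_mono[rotated])
    ultimately show False
      using a b by auto
  qed
  ultimately show ?thesis
    using assms(4) by (auto simp: covered_by_def)
qed

lemma cyclic_subgroups_eq:
  "cyclic_subgroups G = (\<lambda>x. generate G {x}) ` carrier G"
proof (intro equalityI subsetI)
  fix H assume "H \<in> cyclic_subgroups G"
  then have H: "subgroup H G" "cyclic_group (G\<lparr>carrier := H\<rparr>)"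
    by (auto simp: cyclic_subgroups_def)
  then obtain x where x: "x \<in> H"
    and "subgroup_generated (G\<lparr>carrier := H\<rparr>) {x} = G\<lparr>carrier := H\<rparr>"
    by (auto simp: cyclic_group_def)
  then have "carrier (subgroup_generated (G\<lparr>carrier := H\<rparr>) {x}) = H"
    by simp
  then have "generate (G\<lparr>carrier := H\<rparr>) {x} = H"
    using x by (simp add: carrier_subgroup_generated)
  then have "generate G {x} = H"
    using x H(1) by (simp add: generate_consistent)
  then show "H \<in> (\<lambda>x. generate G {x}) ` carrier G"
    using x H(1) by (blast dest: subgroup.mem_carrier)
next
  fix H assume "H \<in> (\<lambda>x. generate G {x}) ` carrier G"
  then obtain x where x: "x \<in> carrier G" and H: "H = generate G {x}"
    by blast
  have sub: "subgroup H G"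
    using x by (simp add: H generate_is_subgroup)
  have "subgroup_generated G {x} = G\<lparr>carrier := H\<rparr>"
    using x by (simp add: subgroup_generated_def H)
  then have "cyclic_group (G\<lparr>carrier := H\<rparr>)"
    using cyclic_group_generated[of x] by simp
  with sub show "H \<in> cyclic_subgroups G"
    by (simp add: cyclic_subgroups_def)
qed

lemma finite_generate:
  assumes "finite (carrier G)" "x \<in> carrier G"
  shows "finite (generate G {x})"
proof (rule finite_subset)
  show "generate G {x} \<subseteq> carrier G"
    using assms(2) by (simp add: generate_incl)
qed (rule assms(1))

lemma generate_pow_subset:
  assumes "x \<in> carrier G"
  shows "generate G {x [^] (k::nat)} \<subseteq> generate G {x}"
proof (rule generate_subgroup_incl)
  show "subgroup (generate G {x}) G"
    using assms by (simp add: generate_is_subgroup)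
  have "x [^] int k \<in> generate G {x}"
    unfolding generate_pow[OF assms] by blast
  then show "{x [^] k} \<subseteq> generate G {x}"
    by (simp add: int_pow_int)
qed

lemma card_generate_prime_pow:
  assumes "finite (carrier G)" "x \<in> carrier G" "Factorial_Ring.prime p" "p dvd ord x"
  shows "card (generate G {x}) = p * card (generate G {x [^] p})"
proof -
  have "ord (x [^] p) = ord x div p"
    using assms by (simp add: ord_pow_gen gcd_proj2_if_dvd prime_gt_0_nat)
  then have "ord x = p * ord (x [^] p)"
    using assms(4) by simp
  then show ?thesis
    using assms(2) by (simp add: generate_pow_card)
qed

lemma generate_prime_pow_covered_by:
  assumes "finite (carrier G)" "x \<in> carrier G" "Factorial_Ring.prime p" "p dvd ord x"
  shows "covered_by G (generate G {x [^] p}) (generate G {x})"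
proof (rule covered_by_if_prime_index)
  show "finite (generate G {x})"
    using assms(1,2) by (rule finite_generate)
  show "subgroup (generate G {x [^] p}) G" "subgroup (generate G {x}) G"
    using assms(2) by (simp_all add: generate_is_subgroup)
  show "generate G {x [^] p} \<subseteq> generate G {x}"
    using assms(2) by (rule generate_pow_subset)
  show "card (generate G {x}) = p * card (generate G {x [^] p})"
    using assms by (rule card_generate_prime_pow)
qed (rule assms(3))

lemma prime_index_if_covered_by:
  assumes fin: "finite (carrier G)" and x: "x \<in> carrier G" and y: "y \<in> carrier G"
    and cov: "covered_by G (generate G {y}) (generate G {x})"
  obtains p where "Factorial_Ring.prime p" "card (generate G {x}) = p * card (generate G {y})"
proof -
  have less: "generate G {y} \<subset> generate G {x}"
    using cov by (simp add: covered_by_def)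
  have "y \<in> generate G {x}"
    using less by (auto intro: generate.incl)
  then obtain k :: nat where k: "y = x [^] k"
    using generate_pow_on_finite_carrier[OF fin x] by auto
  have "\<not> coprime k (ord x)"
  proof
    assume "coprime k (ord x)"
    then have "card (generate G {y}) = card (generate G {x})"
      using pow_ord_eq_ord_iff[OF fin x, of k] x y k by (simp add: generate_pow_card)
    then show False
      using psubset_card_mono[OF finite_generate[OF fin x] less] by simp
  qed
  then have "gcd k (ord x) \<noteq> 1"
    by (simp add: coprime_iff_gcd_eq_1)
  then obtain p where "Factorial_Ring.prime p" "p dvd gcd k (ord x)"
    using prime_factor_nat by blast
  then have p: "Factorial_Ring.prime p" "p dvd k" "p dvd ord x"
    by simp_all
  have "y = (x [^] p) [^] (k div p)"
    using k p(2) x by (simp add: nat_pow_pow)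
  then have "generate G {y} \<subseteq> generate G {x [^] p}"
    using generate_pow_subset[of "x [^] p"] x by simp
  moreover have "subgroup (generate G {x [^] p}) G"
    using x by (simp add: generate_is_subgroup)
  moreover have "generate G {x [^] p} \<subset> generate G {x}"
    using generate_prime_pow_covered_by[OF fin x p(1,3)] by (simp add: covered_by_def)
  ultimately have "generate G {y} = generate G {x [^] p}"
    using cov unfolding covered_by_def by blast
  then show thesis
    using that[OF p(1)] card_generate_prime_pow[OF fin x p(1,3)] by simp
qed

end

section \<open>Walks in the cyclic subgroup graph\<close>

text \<open>
  In a finite group, the walks, walk costs and distances of \<open>cyclic_subgroup_graph G\<close> become
  available by regarding it as an instance of \<open>pair_graph\<close>.
\<close>

locale finite_group = group G for G (structure) +
  assumes fin: "finite (carrier G)"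
begin

abbreviation \<Gamma> :: "'a set pair_pre_digraph" where
  "\<Gamma> \<equiv> cyclic_subgroup_graph G"

text \<open>
  The number of prime divisors of the order of \<open>H\<close>, counted with multiplicity. It is
  meant for the vertices, but defined on all sets.
\<close>

definition height :: "'a set \<Rightarrow> nat" where
  "height H = size (prime_factorization (card H))"

sublocale pair_graph "cyclic_subgroup_graph G"
  by (rule pair_graph_cyclic_subgroup_graph[OF fin])

lemma verts_eq: "pverts \<Gamma> = (\<lambda>x. generate G {x}) ` carrier G"
  by (simp add: cyclic_subgroup_graph_def cyclic_subgroups_eq)

lemma height_generate:
  "x \<in> carrier G \<Longrightarrow> height (generate G {x}) = size (prime_factorization (ord x))"
  by (simp add: height_def generate_pow_card)

lemma height_trivial: "height {\<one>} = 0"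
  by (simp add: height_def)

lemma trivial_in_verts: "{\<one>} \<in> pverts \<Gamma>"
  unfolding verts_eq by (rule image_eqI[of _ _ \<one>]) (simp_all add: generate_one)

lemma height_if_covered_by:
  assumes "H \<in> pverts \<Gamma>" "K \<in> pverts \<Gamma>" "covered_by G H K"
  shows "height K = Suc (height H)"
proof -
  obtain x y where x: "x \<in> carrier G" "K = generate G {x}"
    and y: "y \<in> carrier G" "H = generate G {y}"
    using assms by (auto simp: verts_eq)
  obtain p where "Factorial_Ring.prime p" "card K = p * card H"
    using prime_index_if_covered_by[OF fin x(1) y(1)] assms(3) x y by metis
  moreover have "card H > 0"
    using ord_ge_1[OF fin y(1)] y by (simp add: generate_pow_card)
  ultimately show ?thesis
    by (simp add: height_def size_prime_factorization_prime_mult)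
qed

lemma height_le_if_arc:
  assumes "(H, K) \<in> parcs \<Gamma>"
  shows "height H \<le> Suc (height K)"
proof -
  have "H \<in> pverts \<Gamma>" "K \<in> pverts \<Gamma>" "covered_by G H K \<or> covered_by G K H"
    using assms by (auto simp: cyclic_subgroup_graph_def)
  then show ?thesis
    using height_if_covered_by[of H K] height_if_covered_by[of K H] by auto
qed

lemma height_le_if_awalk:
  assumes "awalk H p K"
  shows "height H \<le> height K + length p"
  using assms
proof (induction p arbitrary: H)
  case Nil
  then show ?case by (simp add: awalk_Nil_iff)
next
  case (Cons e p)
  obtain A B where e: "e = (A, B)"
    by (cases e)
  from Cons.prems have "(H, B) \<in> parcs \<Gamma>" "awalk B p K"
    by (auto simp: awalk_Cons_iff e)
  then show ?case
    using Cons.IH[of B] height_le_if_arc[of H B] by simp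
qed

lemma walk_to_trivial:
  assumes "H \<in> pverts \<Gamma>"
  shows "\<exists>p. awalk H p {\<one>} \<and> length p = height H"
  using assms
proof (induction "height H" arbitrary: H)
  case 0
  obtain x where x: "x \<in> carrier G" "H = generate G {x}"
    using "0.prems" by (auto simp: verts_eq)
  have "prime_factorization (ord x) = {#}"
    using "0.hyps" x by (simp add: height_generate)
  then have "ord x = 1"
    using ord_ge_1[OF fin x(1)] by (simp add: prime_factorization_empty_iff)
  then have "x = \<one>"
    using ord_eq_1 x(1) by blast
  then have "H = {\<one>}"
    using x by (simp add: generate_one)
  then show ?case
    by (intro exI[of _ "[]"]) (simp add: awalk_Nil_iff trivial_in_verts height_trivial)
next
  case (Suc n)
  obtain x where x: "x \<in> carrier G" "H = generate G {x}"
    using Suc.prems by (auto simp: verts_eq)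
  have "ord x \<noteq> 1"
  proof
    assume "ord x = 1"
    then have "height H = 0"
      using x by (simp add: height_generate)
    then show False
      using Suc.hyps(2) by simp
  qed
  then obtain p where p: "Factorial_Ring.prime p" "p dvd ord x"
    using prime_factor_nat by blast
  define K where "K = generate G {x [^] p}"
  have K: "K \<in> pverts \<Gamma>"
    using x by (auto simp: verts_eq K_def)
  have cov: "covered_by G K H"
    using generate_prime_pow_covered_by[OF fin x(1) p] x by (simp add: K_def)
  have height: "height H = Suc (height K)"
    by (rule height_if_covered_by[OF K Suc.prems cov])
  then have "n = height K"
    using Suc.hyps(2) by simp
  then obtain q where "awalk K q {\<one>}" "length q = height K"
    using Suc.hyps(1) K by blast
  moreover have "(H, K) \<in> parcs \<Gamma>"
    using K Suc.prems cov by (simp add: cyclic_subgroup_graph_def)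
  ultimately show ?case
    using height Suc.prems by (intro exI[of _ "(H, K) # q"]) (simp add: awalk_Cons_iff)
qed

lemma awalk_cost_unit: "awalk_cost (\<lambda>_. 1) p = length p"
  by (simp add: awalk_cost_def sum_list_triv)

lemma height_le_graph_distance:
  assumes "height K = 0"
  shows "ereal (real (height H)) \<le> graph_distance (with_proj \<Gamma>) H K"
  unfolding graph_distance_def \<mu>_def
  using height_le_if_awalk[of H _ K] assms by (intro INF_greatest) (auto simp: awalk_cost_unit)

lemma length_rev_path: "length (rev_path p) = length p"
  by (induction p) simp_all

lemma graph_distance_le_height_sum:
  assumes "H \<in> pverts \<Gamma>" "K \<in> pverts \<Gamma>"
  shows "graph_distance (with_proj \<Gamma>) H K \<le> ereal (real (height H + height K))"
proof -
  obtain p where p: "awalk H p {\<one>}" "length p = height H"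
    using walk_to_trivial assms by blast
  obtain q where q: "awalk K q {\<one>}" "length q = height K"
    using walk_to_trivial assms by blast
  have "awalk H (p @ rev_path q) K"
    using p(1) q(1) by (simp add: awalk_appendI)
  from min_cost_le_walk_cost[OF this, of "\<lambda>_. 1"] show ?thesis
    using p(2) q(2) by (simp add: graph_distance_def awalk_cost_unit length_rev_path)
qed

end

theorem theorem2p11:
  fixes G :: "('a, 'b) monoid_scheme" and g :: 'a and r :: nat
  assumes "group G"
    and "finite (carrier G)"
    and "g \<in> carrier G"
    and "\<forall>x\<in>carrier G. size (prime_factorization (group.ord G x))
                        \<le> size (prime_factorization (group.ord G g))"
    and "r = size (prime_factorization (group.ord G g))"
  shows "ereal (real r) \<le> diameter (with_proj (cyclic_subgroup_graph G)) \<and>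
         diameter (with_proj (cyclic_subgroup_graph G)) \<le> ereal (real (2 * r))"
proof -
  interpret finite_group G
    by (intro finite_group.intro finite_group_axioms.intro assms(1,2))
  have g: "generate G {g} \<in> pverts \<Gamma>" "height (generate G {g}) = r"
    using assms(3,5) by (auto simp: verts_eq height_generate)
  have le: "height H \<le> r" if "H \<in> pverts \<Gamma>" for H
    using that assms(4,5) by (auto simp: verts_eq height_generate)
  have "ereal (real r) \<le> graph_distance (with_proj \<Gamma>) (generate G {g}) {\<one>\<^bsub>G\<^esub>}"
    using height_le_graph_distance[OF height_trivial, of "generate G {g}"] g(2) by simp
  also have "\<dots> \<le> diameter (with_proj \<Gamma>)"
    unfolding diameter_def
    by (rule SUP_upper2[of "(generate G {g}, {\<one>\<^bsub>G\<^esub>})"]) (use g trivial_in_verts in auto)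
  finally have lower: "ereal (real r) \<le> diameter (with_proj \<Gamma>)" .
  have "graph_distance (with_proj \<Gamma>) H K \<le> ereal (real (2 * r))"
    if "H \<in> pverts \<Gamma>" "K \<in> pverts \<Gamma>" for H K
    using graph_distance_le_height_sum[OF that] le[OF that(1)] le[OF that(2)]
    by (elim order_trans) simp
  then have "diameter (with_proj \<Gamma>) \<le> ereal (real (2 * r))"
    unfolding diameter_def by (intro SUP_least) auto
  with lower show ?thesis ..
qed

end
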